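(* Let $G$ be a finite simple undirected $2$-connected graph with degree sequence $d_1\le d_2\le\ldots\le d_n$ and minimum degree $\delta=d_1$. Let $c$ be the order of a longest cycle in $G$ and $p$ the order of a longest path in $G$. Then $c\ge\min\{p,\,d_\delta+d_{\delta+1}\}$.
   Context: Graphs are finite and undirected, with neither loops nor multiple edges. The number of vertices of $G$ is $n$. A graph is $2$-connected if its vertex connectivity is at least $2$ (in particular it has at least $3$ vertices). The degree sequence $d_1\le d_2\le\ldots\le d_n$ lists the degrees of all $n$ vertices of $G$ in nondecreasing order, indexed from $1$; its first term $d_1$ is the minimum degree of $G$, denoted $\delta$. Thus $d_\delta$ and $d_{\delta+1}$ are the $\delta$-th and $(\delta+1)$-th terms of this sequence. The order of a cycle or path is its number of vertices. *)

theory Defs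
  imports "Graph_Theory.Graph_Theory" "HOL-Library.Multiset"
begin

text \<open>
  A finite simple undirected graph is a symmetric digraph without loops and parallel arcs
  (locale \<^locale>\<open>graph\<close>): each edge is a pair of opposite arcs, so the degree of a vertex is its
  out-degree.
\<close>

abbreviation degree :: "('a, 'b) pre_digraph \<Rightarrow> 'a \<Rightarrow> nat" where
  "degree G v \<equiv> out_degree G v"

definition min_degree :: "('a, 'b) pre_digraph \<Rightarrow> nat" where
  "min_degree G = Min (degree G ` verts G)"

definition degree_sequence :: "('a, 'b) pre_digraph \<Rightarrow> nat list" where
  "degree_sequence G = sorted_list_of_multiset (image_mset (degree G) (mset_set (verts G)))"

text \<open>
  The terms are numbered from 1; \<open>degree_term G k\<close> is meaningful only for
  \<open>1 \<le> k \<le> card (verts G)\<close>.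
\<close>

definition degree_term :: "('a, 'b) pre_digraph \<Rightarrow> nat \<Rightarrow> nat" where
  "degree_term G k = degree_sequence G ! (k - 1)"

lemma degree_term_1:
  assumes "finite (verts G)" "verts G \<noteq> {}"
  shows "degree_term G 1 = min_degree G"
proof -
  let ?xs = "degree_sequence G"
  have set: "set ?xs = degree G ` verts G"
    using assms(1) by (simp add: degree_sequence_def)
  have "sorted ?xs"
    by (simp add: degree_sequence_def)
  moreover obtain x ys where xs: "?xs = x # ys"
    using set assms(2) by (cases ?xs) auto
  ultimately have "Min (set ?xs) = x"
    by (intro Min_eqI) auto
  with set xs show ?thesis
    by (simp add: degree_term_def min_degree_def)
qed

text \<open>
  The vertex connectivity is the least number of vertices whose removal leaves a graph that is
  disconnected or has a single vertex. Thus complete graphs on \<open>n\<close> vertices have vertex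
  connectivity \<open>n - 1\<close>. (The graph without vertices is not \<^const>\<open>connected\<close>.)
\<close>

definition vertex_connectivity :: "('a, 'b) pre_digraph \<Rightarrow> nat" where
  "vertex_connectivity G =
     (LEAST k. \<exists>S \<subseteq> verts G. card S = k \<and>
        (\<not> connected (G \<restriction> (verts G - S)) \<or> card (verts G - S) = 1))"

definition two_connected :: "('a, 'b) pre_digraph \<Rightarrow> bool" where
  "two_connected G \<longleftrightarrow> 2 \<le> vertex_connectivity G"

text \<open>
  In a symmetric digraph, \<^const>\<open>pre_digraph.cycle\<close> also holds of the walk along an edge and back,
  which is not a cycle of the undirected graph; the bound on the length excludes it. A cycle is
  given by its arcs, which are as many as its vertices, whereas a \<^const>\<open>vpath\<close> is given by its
  vertices.
\<close>

definition longest_cycle_order :: "('a, 'b) pre_digraph \<Rightarrow> nat" where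
  "longest_cycle_order G = Max {length p | p. pre_digraph.cycle G p \<and> 3 \<le> length p}"

definition longest_path_order :: "('a, 'b) pre_digraph \<Rightarrow> nat" where
  "longest_path_order G = Max {length p | p. vpath p G}"

end

theory Submission
  imports Defs
begin

text \<open>
  Let \<open>P\<close> be a longest path with ends \<open>u\<close> and \<open>v\<close>; all neighbours of \<open>u\<close> and \<open>v\<close> lie on \<open>P\<close>. Then some
  cycle has at least \<open>min p (d(u) + d(v))\<close> vertices. If a neighbour \<open>P i\<close> of \<open>v\<close> precedes a neighbour \<open>P j\<close>
  of \<open>u\<close>, a pair with \<open>j - i\<close> minimal yields a cycle missing only the vertices strictly between, and
  counting neighbours of \<open>u\<close> and successors of neighbours of \<open>v\<close> bounds its length. Otherwise the
  neighbours of \<open>u\<close> lie before those of \<open>v\<close>, and two disjoint paths linking the two parts of \<open>P\<close>, one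
  leaving from the last neighbour of \<open>u\<close> and one arriving at the first neighbour of \<open>v\<close>, are completed
  to a cycle through both closed neighbourhoods.

  Finally, rotating a longest path at one end yields at least \<open>\<delta>\<close> possible ends while the other end stays
  fixed. Rotating at \<open>u\<close> gives an end \<open>x\<close> of degree at least \<open>d\<^sub>\<delta>\<close>. Rotating at the other end
  with \<open>x\<close> fixed gives \<open>\<delta>\<close> further vertices, and among these and \<open>x\<close> one has degree at least
  \<open>d\<^bsub>\<delta>+1\<^esub>\<close>.
\<close>

section \<open>Paths and their vertex sets\<close>

text \<open>
  A path is recorded only by its vertex set and its ends; a cycle is such a path whose ends
  are adjacent.
\<close>

inductive path_on :: "('a \<Rightarrow> 'a \<Rightarrow> bool) \<Rightarrow> 'a set \<Rightarrow> 'a \<Rightarrow> 'a \<Rightarrow> bool" for E where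
  single: "path_on E {u} u u"
| step: "E u v \<Longrightarrow> path_on E X v w \<Longrightarrow> u \<notin> X \<Longrightarrow> path_on E (insert u X) u w"

lemma path_on_finite: "path_on E X u v \<Longrightarrow> finite X"
  by (induction rule: path_on.induct) auto

lemma path_on_ends: "path_on E X u v \<Longrightarrow> u \<in> X \<and> v \<in> X"
  by (induction rule: path_on.induct) auto

lemma path_on_subset:
  assumes "path_on E X u v" "u \<in> V" "\<And>x y. E x y \<Longrightarrow> y \<in> V"
  shows "X \<subseteq> V"
  using assms(1,2)
proof (induction rule: path_on.induct)
  case (single u)
  then show ?case by simp
next
  case (step u v X w)
  then show ?case using assms(3)[OF step.hyps(1)] by simp
qed

lemma path_on_bridge:
  assumes "path_on E X u v" "E v v'" "path_on E Y v' w" "X \<inter> Y = {}"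
  shows "path_on E (X \<union> Y) u w"
  using assms
proof (induction rule: path_on.induct)
  case (single u)
  then show ?case using path_on.step[of E u v' Y w] by auto
next
  case (step u v X w')
  then show ?case using path_on.step[of E u v "X \<union> Y" w] by auto
qed

lemma path_on_join:
  assumes "path_on E X u v" "path_on E Y v w" "X \<inter> Y = {v}"
  shows "path_on E (X \<union> Y) u w"
  using assms
proof (induction rule: path_on.induct)
  case (single u)
  then have "{u} \<union> Y = Y" by auto
  with single show ?case by simp
next
  case (step u v X w')
  have "w' \<in> X" using path_on_ends[OF step.hyps(2)] by simp
  with step have "X \<inter> Y = {w'}" "u \<notin> Y" by auto
  with step show ?case using path_on.step[of E u v "X \<union> Y" w] by auto
qed

lemma path_on_rev:
  assumes "path_on E X u v" "symp E"
  shows "path_on E X v u"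
  using assms
proof (induction rule: path_on.induct)
  case (single u)
  show ?case by (rule path_on.single)
next
  case (step u v X w)
  then have "path_on E (X \<union> {u}) w u"
    by (intro path_on_bridge[of E X w v u "{u}" u]) (auto dest: sympD intro: path_on.single)
  then show ?case by simp
qed

lemma path_on_split:
  assumes "path_on E X u v" "w \<in> X"
  shows "\<exists>X1 X2. path_on E X1 u w \<and> path_on E X2 w v \<and> X1 \<union> X2 = X \<and> X1 \<inter> X2 = {w}"
  using assms
proof (induction rule: path_on.induct)
  case (single u)
  then have "w = u" by simp
  with path_on.single[of E u] show ?case by (intro exI[of _ "{u}"]) simp
next
  case (step u v X w')
  show ?case
  proof (cases "w = u")
    case True
    then show ?thesis using path_on.step[OF step.hyps] path_on.single[of E u]
      by (intro exI[of _ "{u}"] exI[of _ "insert u X"]) simp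
  next
    case False
    then have "w \<in> X" using step.prems by simp
    then obtain X1 X2 where *: "path_on E X1 v w" "path_on E X2 w w'" "X1 \<union> X2 = X" "X1 \<inter> X2 = {w}"
      using step.IH by blast
    then have "u \<notin> X1" "u \<notin> X2" using step.hyps(3) by auto
    then have "path_on E (insert u X1) u w" using path_on.step[OF step.hyps(1) *(1)] by simp
    moreover have "insert u X1 \<union> X2 = insert u X" "insert u X1 \<inter> X2 = {w}"
      using * \<open>u \<notin> X2\<close> by auto
    ultimately show ?thesis using *(2) by (intro exI[of _ "insert u X1"] exI[of _ X2]) simp
  qed
qed

text \<open>Each vertex of the first path, taken from its end backwards, either extends the path
  built so far or already lies on it, in which case the detour is cut off.\<close>

lemma path_on_walk_join:
  assumes "path_on E X u v" "path_on E Y v w"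
  shows "\<exists>Z \<subseteq> X \<union> Y. path_on E Z u w"
  using assms
proof (induction rule: path_on.induct)
  case (single u)
  then show ?case by (intro exI[of _ Y]) auto
next
  case (step u v X w')
  then obtain Z where Z: "Z \<subseteq> X \<union> Y" "path_on E Z v w" by auto
  show ?case
  proof (cases "u \<in> Z")
    case True
    then obtain Z' where "path_on E Z' u w" "Z' \<subseteq> Z" using path_on_split[OF Z(2)] by blast
    with Z(1) show ?thesis by (intro exI[of _ Z']) auto
  next
    case False
    then have "path_on E (insert u Z) u w" using path_on.step[OF step.hyps(1) Z(2)] by simp
    with Z(1) show ?thesis by (intro exI[of _ "insert u Z"]) auto
  qed
qed

text \<open>Removing \<open>u\<close> from the second path leaves a path between \<open>v\<close>
  and a neighbour \<open>w\<close> of \<open>u\<close>; it prolongs the first path up to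
  \<open>w\<close>.\<close>

lemma path_on_close:
  assumes "symp E" "path_on E X u v" "path_on E Y v u" "X \<inter> Y = {u, v}" "u \<noteq> v"
  shows "\<exists>w. path_on E (X \<union> Y) u w \<and> E w u"
proof -
  have "path_on E Y u v" using assms(1,3) by (rule path_on_rev[rotated])
  then show ?thesis
  proof cases
    case single
    with assms(5) show ?thesis by simp
  next
    case (step w Y')
    have "path_on E Y' v w" using path_on_rev[OF step(3) assms(1)] .
    moreover have "X \<inter> Y' = {v}" using step assms(4,5) path_on_ends[OF step(3)] by auto
    ultimately have "path_on E (X \<union> Y') u w" using path_on_join[OF assms(2)] by blast
    moreover have "X \<union> Y' = X \<union> Y" using step(1) path_on_ends[OF assms(2)] by auto
    ultimately show ?thesis using step(2) assms(1) by (auto dest: sympD)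
  qed
qed

lemma path_on_enumeration:
  assumes "path_on E X u v"
  shows "\<exists>P. inj_on P {..<card X} \<and> P ` {..<card X} = X \<and> P 0 = u \<and> P (card X - 1) = v \<and>
    (\<forall>i. Suc i < card X \<longrightarrow> E (P i) (P (Suc i)))"
  using assms
proof (induction rule: path_on.induct)
  case (single u)
  show ?case by (intro exI[of _ "\<lambda>_. u"]) (auto simp: inj_on_def)
next
  case (step u v X w)
  then obtain P where P: "inj_on P {..<card X}" "P ` {..<card X} = X" "P 0 = v" "P (card X - 1) = w"
    "\<And>i. Suc i < card X \<Longrightarrow> E (P i) (P (Suc i))"
    by auto
  have fin: "finite X" using path_on_finite[OF step.hyps(2)] .
  have pos: "card X > 0" using path_on_ends[OF step.hyps(2)] fin by (auto simp: card_gt_0_iff)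
  have card: "card (insert u X) = Suc (card X)" using fin step.hyps by simp
  let ?Q = "case_nat u P"
  have img: "?Q ` {..<Suc (card X)} = insert u X"
    unfolding lessThan_Suc_eq_insert_0 using P(2) by (auto simp: image_image)
  have "inj_on ?Q {..<Suc (card X)}"
    by (rule eq_card_imp_inj_on) (use img card in auto)
  moreover have "?Q (card (insert u X) - 1) = w" using P(4) pos card by (cases "card X") auto
  moreover have "\<forall>i. Suc i < Suc (card X) \<longrightarrow> E (?Q i) (?Q (Suc i))"
    using P(3,5) step.hyps(1) by (auto split: nat.split)
  ultimately show ?case using img card by (intro exI[of _ ?Q]) auto
qed

lemma path_on_segment:
  assumes "inj_on P {..n}" "\<And>i. i < n \<Longrightarrow> E (P i) (P (Suc i))" "i \<le> j" "j \<le> n"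
  shows "path_on E (P ` {i..j}) (P i) (P j)"
  using assms(3)
proof (induction i rule: inc_induct)
  case base
  show ?case using path_on.single[of E "P j"] by simp
next
  case (step k)
  have "path_on E (insert (P k) (P ` {Suc k..j})) (P k) (P j)"
  proof (rule path_on.step[OF assms(2) step.IH])
    show "k < n" using step.hyps assms(4) by simp
    show "P k \<notin> P ` {Suc k..j}" using assms(1,4) step.hyps by (force simp: inj_on_def)
  qed
  moreover have "{k..j} = insert k {Suc k..j}" using step.hyps by auto
  ultimately show ?case by simp
qed

section \<open>Ears over a path\<close>

text \<open>\<open>conn\<close> says that there is no cut vertex: deleting any \<open>c\<close>
  leaves a connected graph. \<open>EV\<close> speaks of targets only; \<open>symE\<close> extends it
  to sources.\<close>

locale two_connected_relation =
  fixes E :: "'a \<Rightarrow> 'a \<Rightarrow> bool" and V :: "'a set"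
  assumes finite_V: "finite V"
    and symE: "symp E"
    and irrefl: "\<not> E v v"
    and EV: "E u v \<Longrightarrow> v \<in> V"
    and card_V: "3 \<le> card V"
    and conn: "\<lbrakk>c \<in> V; u \<in> V; v \<in> V; u \<noteq> c; v \<noteq> c\<rbrakk> \<Longrightarrow> (\<lambda>x y. E x y \<and> x \<noteq> c \<and> y \<noteq> c)\<^sup>*\<^sup>* u v"
begin

lemma E_sym: "E u v \<Longrightarrow> E v u"
  using symE by (rule sympD)

lemma finite_nbrs [simp]: "finite {v. E u v}"
  using finite_subset[OF _ finite_V, of "{v. E u v}"] EV by auto

lemma nbr_avoiding:
  assumes "u \<in> V" "c \<in> V" "c \<noteq> u"
  shows "\<exists>v. E u v \<and> v \<noteq> c"
proof -
  have "card {u, c} \<le> 2" by (simp add: card_insert_if)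
  then have "\<not> V \<subseteq> {u, c}" using card_V card_mono[of "{u, c}" V] by auto
  then obtain w where "w \<in> V" "w \<noteq> u" "w \<noteq> c" by auto
  then have "(\<lambda>x y. E x y \<and> x \<noteq> c \<and> y \<noteq> c)\<^sup>*\<^sup>* u w" using assms by (intro conn) auto
  then show ?thesis using \<open>w \<noteq> u\<close> by (cases rule: converse_rtranclpE) auto
qed

lemma degree_ge_2:
  assumes "u \<in> V"
  shows "2 \<le> card {v. E u v}"
proof -
  have "\<not> V \<subseteq> {u}" using card_V card_mono[of "{u}" V] by auto
  then obtain c where "c \<in> V" "c \<noteq> u" by auto
  then obtain v where v: "E u v" using nbr_avoiding assms by blast
  then obtain w where w: "E u w" "w \<noteq> v" using nbr_avoiding[OF assms EV[OF v]] irrefl by metis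
  have "card {v, w} \<le> card {v. E u v}" by (rule card_mono) (use v w in auto)
  with w(2) show ?thesis by simp
qed

end

text \<open>\<open>n\<close> is the last index, so the path has \<open>n + 1\<close> vertices.
  Maximality of a longest path enters only through \<open>first_nbrs\<close> and
  \<open>last_nbrs\<close>.\<close>

locale path_in_two_connected = two_connected_relation +
  fixes P :: "nat \<Rightarrow> 'a" and n :: nat
  assumes inj: "inj_on P {..n}"
    and PE: "i < n \<Longrightarrow> E (P i) (P (Suc i))"
    and P0: "P 0 \<in> V"
    and first_nbrs: "E (P 0) v \<Longrightarrow> v \<in> P ` {..n}"
    and last_nbrs: "E (P n) v \<Longrightarrow> v \<in> P ` {..n}"
begin

lemma P_eq [simp]: "i \<le> n \<Longrightarrow> j \<le> n \<Longrightarrow> P i = P j \<longleftrightarrow> i = j"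
  using inj by (auto simp: inj_on_def)

lemma P_in_V: "i \<le> n \<Longrightarrow> P i \<in> V"
proof (cases i)
  case (Suc j)
  then show "i \<le> n \<Longrightarrow> ?thesis" using EV[OF PE[of j]] by simp
qed (simp add: P0)

lemma segment: "i \<le> j \<Longrightarrow> j \<le> n \<Longrightarrow> path_on E (P ` {i..j}) (P i) (P j)"
  using path_on_segment[of P n E i j] inj PE by simp

lemma segment_rev: "i \<le> j \<Longrightarrow> j \<le> n \<Longrightarrow> path_on E (P ` {i..j}) (P j) (P i)"
  by (rule path_on_rev[OF segment symE])

text \<open>The edges of \<open>P\<close> count as ears, too.\<close>

definition ear :: "'a set \<Rightarrow> nat \<Rightarrow> nat \<Rightarrow> bool" where
  "ear X x y \<longleftrightarrow> y \<le> n \<and> path_on E X (P x) (P y) \<and> (\<forall>i\<le>n. P i \<in> X \<longrightarrow> i = x \<or> i = y)"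

text \<open>\<open>P l\<close> is not a cut vertex. Without an ear over it, the vertices attached to
  the part of \<open>P\<close> before it would be closed under the edges avoiding
  \<open>P l\<close>, and so would include \<open>P n\<close>.\<close>

lemma ear_across:
  assumes "0 < l" "l < n"
  shows "\<exists>x<l. \<exists>y>l. \<exists>X. ear X x y"
proof (rule ccontr)
  assume no: "\<not> ?thesis"
  \<comment> \<open>\<open>D\<close> holds on that part of \<open>P\<close> and for the vertices off
    \<open>P\<close> that reach it by a path with no other vertex on \<open>P\<close>.\<close>
  define D where "D w \<longleftrightarrow> (\<exists>i<l. w = P i) \<or>
     w \<notin> P ` {..n} \<and> (\<exists>x<l. \<exists>X. path_on E X w (P x) \<and> (\<forall>i\<le>n. P i \<in> X \<longrightarrow> i = x))" for w
  have "(\<lambda>x y. E x y \<and> x \<noteq> P l \<and> y \<noteq> P l)\<^sup>*\<^sup>* (P 0) (P n)"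
    using assms by (intro conn P_in_V) auto
  then have "D (P n)"
  proof (induction rule: rtranclp_induct)
    case base
    show ?case using assms D_def by blast
  next
    case (step w w')
    obtain x X where X: "x < l" "path_on E X w (P x)" "\<forall>i\<le>n. P i \<in> X \<longrightarrow> i = x"
    proof (cases "\<exists>i<l. w = P i")
      case True
      then show ?thesis using that path_on.single[of E w] assms(2) by fastforce
    next
      case False
      then show ?thesis using step.IH that D_def by blast
    qed
    show ?case
    proof (cases "w' \<in> P ` {..n}")
      case True
      then obtain j where j: "w' = P j" "j \<le> n" by auto
      have "j < l"
      proof (rule ccontr)
        assume "\<not> j < l"
        then have jl: "l < j" using step.hyps j by (cases "j = l") auto
        then have "P j \<notin> X" using X j by auto
        then have "path_on E (insert (P j) X) (P j) (P x)"
          using X(2) step.hyps j(1) by (intro path_on.step) (auto intro: E_sym)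
        then have "ear (insert (P j) X) x j"
          unfolding ear_def using path_on_rev[OF _ symE] X(3) j(2) by auto
        then show False using no X(1) jl by blast
      qed
      then show ?thesis using j D_def by blast
    next
      case False
      have "\<exists>Y. path_on E Y w' (P x) \<and> (\<forall>i\<le>n. P i \<in> Y \<longrightarrow> i = x)"
      proof (cases "w' \<in> X")
        case True
        then show ?thesis using path_on_split[OF X(2) True] X(3) by blast
      next
        case False2: False
        then have "path_on E (insert w' X) w' (P x)"
          using X(2) step.hyps by (intro path_on.step) (auto intro: E_sym)
        moreover have "\<forall>i\<le>n. P i \<in> insert w' X \<longrightarrow> i = x" using X(3) False by auto
        ultimately show ?thesis by blast
      qed
      then show ?thesis using False X(1) D_def by blast
    qed
  qed
  then show False using assms unfolding D_def by auto
qed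

text \<open>Keeps later ears away from \<open>X\<close>: an ear running through a vertex of
  \<open>X\<close> off \<open>P\<close> continues from there to its far end, whose index is then at
  most \<open>l\<close>.\<close>

definition bounded_reach :: "nat \<Rightarrow> 'a set \<Rightarrow> bool" where
  "bounded_reach l X \<longleftrightarrow> (\<forall>w \<in> X - P ` {..n}. \<forall>Y y. y \<le> n \<longrightarrow> path_on E Y w (P y) \<longrightarrow>
     (\<forall>i\<le>n. P i \<in> Y \<longrightarrow> i = y) \<longrightarrow> y \<le> l)"

lemma bounded_reach_subset_Un:
  assumes "bounded_reach l X" "bounded_reach l Y" "Z - P ` {..n} \<subseteq> X \<union> Y"
  shows "bounded_reach l Z"
  unfolding bounded_reach_def
proof
  fix w assume "w \<in> Z - P ` {..n}"
  then have "w \<in> X - P ` {..n} \<or> w \<in> Y - P ` {..n}" using assms(3) by blast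
  then show "\<forall>Y y. y \<le> n \<longrightarrow> path_on E Y w (P y) \<longrightarrow> (\<forall>i\<le>n. P i \<in> Y \<longrightarrow> i = y) \<longrightarrow> y \<le> l"
    using assms(1,2) unfolding bounded_reach_def by (elim disjE) (rule bspec, assumption+)+
qed

lemma bounded_reach_mono:
  assumes "bounded_reach l X" "l \<le> l'"
  shows "bounded_reach l' X"
  unfolding bounded_reach_def
proof (intro ballI allI impI)
  fix w Y y
  assume "w \<in> X - P ` {..n}" "y \<le> n" "path_on E Y w (P y)" "\<forall>i\<le>n. P i \<in> Y \<longrightarrow> i = y"
  then have "y \<le> l" using assms(1) unfolding bounded_reach_def by blast
  with assms(2) show "y \<le> l'" by simp
qed

text \<open>\<open>y\<close> is the largest index reached by ears starting before \<open>l\<close>.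
  The reach bound follows: leaving \<open>Q\<close> at \<open>w\<close> and landing beyond index
  \<open>y\<close> would give an ear from \<open>P x\<close> that reaches farther.\<close>

lemma maximal_ear:
  assumes "0 < l" "l < n"
  obtains x y Q where "x < l" "l < y" "ear Q x y"
    and "\<And>x' y' Q'. x' < l \<Longrightarrow> ear Q' x' y' \<Longrightarrow> y' \<le> y"
    and "bounded_reach y Q"
proof -
  let ?S = "{y. \<exists>x<l. \<exists>Q. ear Q x y}"
  have fin: "finite ?S" by (rule finite_subset[of _ "{..n}"]) (auto simp: ear_def)
  obtain x0 y0 Q0 where 0: "x0 < l" "l < y0" "ear Q0 x0 y0" using ear_across[OF assms] by blast
  define y where "y = Max ?S"
  have max: "y' \<le> y" if "x' < l" "ear Q' x' y'" for x' y' Q'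
    unfolding y_def using fin that by (intro Max_ge) auto
  have "y \<in> ?S" unfolding y_def using fin 0 by (intro Max_in) auto
  then obtain x Q where xQ: "x < l" "ear Q x y" by blast
  have "l < y" using max[OF 0(1,3)] 0(2) by simp
  moreover have "bounded_reach y Q"
    unfolding bounded_reach_def
  proof (intro ballI allI impI)
    fix w Y y'
    assume w: "w \<in> Q - P ` {..n}" and Y: "y' \<le> n" "path_on E Y w (P y')" "\<forall>i\<le>n. P i \<in> Y \<longrightarrow> i = y'"
    show "y' \<le> y"
    proof (rule ccontr)
      assume less: "\<not> y' \<le> y"
      have Q: "path_on E Q (P x) (P y)" "y \<le> n" "\<forall>i\<le>n. P i \<in> Q \<longrightarrow> i = x \<or> i = y"
        using xQ by (auto simp: ear_def)
      obtain Q1 Q2 where Q12: "path_on E Q1 (P x) w" "path_on E Q2 w (P y)" "Q1 \<union> Q2 = Q" "Q1 \<inter> Q2 = {w}"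
        using path_on_split[OF Q(1)] w by blast
      have "P y \<noteq> w" using w Q(2) by auto
      then have "P y \<notin> Q1" using Q12 path_on_ends[OF Q12(2)] by blast
      obtain Z where Z: "Z \<subseteq> Q1 \<union> Y" "path_on E Z (P x) (P y')"
        using path_on_walk_join[OF Q12(1) Y(2)] by blast
      have "ear Z x y'" unfolding ear_def using Z Y Q12(3) Q(3) \<open>P y \<notin> Q1\<close> by blast
      then show False using max[OF xQ(1)] less by blast
    qed
  qed
  ultimately show ?thesis using that xQ max by blast
qed

text \<open>Which of \<open>P x\<close> and \<open>P a\<close> is joined to \<open>P k\<close> stays
  open, since the two paths exchange roles in every round of the construction. The last condition
  controls where they meet the parts of \<open>P\<close> that later complete the cycle.\<close>

definition linkage :: "nat \<Rightarrow> nat \<Rightarrow> nat \<Rightarrow> nat \<Rightarrow> bool" where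
  "linkage x a k l \<longleftrightarrow> (\<exists>s s' R S. {s, s'} = {x, a} \<and> path_on E R (P s) (P k) \<and> path_on E S (P s') (P l) \<and>
     R \<inter> S = {} \<and> (\<forall>i\<le>n. P i \<in> R \<union> S \<longrightarrow> i = x \<or> a \<le> i \<and> i \<le> k \<or> i = l))"

text \<open>
  The linking paths are grown towards \<open>P n\<close> by alternately extending the one that lags behind, along
  \<open>P\<close> and then over an ear reaching as far as possible. The maximality of the earlier ears keeps the
  new ear disjoint from both paths.
\<close>

definition growing :: "nat \<Rightarrow> nat \<Rightarrow> nat \<Rightarrow> nat \<Rightarrow> nat \<Rightarrow> nat \<Rightarrow> 'a set \<Rightarrow> 'a set \<Rightarrow> bool" where
  "growing x a s s' k l R S \<longleftrightarrow> {s, s'} = {x, a} \<and> x < a \<and> a \<le> k \<and> k < l \<and> l \<le> n \<and>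
     path_on E R (P s) (P k) \<and> path_on E S (P s') (P l) \<and> R \<inter> S = {} \<and>
     (\<forall>i\<le>n. P i \<in> R \<union> S \<longrightarrow> i = x \<or> a \<le> i \<and> i \<le> k \<or> i = l) \<and>
     (\<forall>x' y' X. x' < k \<longrightarrow> ear X x' y' \<longrightarrow> y' \<le> l) \<and> bounded_reach l (R \<union> S)"

text \<open>\<open>R\<close> is the lagging path, ending at \<open>P k\<close>, and \<open>S\<close>
  the leading one, ending at \<open>P l\<close>. Once \<open>l\<close> exceeds \<open>b\<close>,
  \<open>R\<close> follows \<open>P\<close> to \<open>P b\<close>; before that, each round moves the
  leading end strictly forward, whence the induction on \<open>n - l\<close>.\<close>

lemma linkage_of_growing:
  assumes "growing x a s s' k l R S" "k \<le> b" "b < n"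
  shows "\<exists>l'>b. l' \<le> n \<and> linkage x a b l'"
  using assms(1,2)
proof (induction "n - l" arbitrary: s s' k l R S rule: less_induct)
  case less
  from less.prems(1) have ss: "{s, s'} = {x, a}" and ord: "x < a" "a \<le> k" "k < l" "l \<le> n"
    and R: "path_on E R (P s) (P k)" and S: "path_on E S (P s') (P l)" and RS: "R \<inter> S = {}"
    and idx: "\<And>i. i \<le> n \<Longrightarrow> P i \<in> R \<union> S \<Longrightarrow> i = x \<or> a \<le> i \<and> i \<le> k \<or> i = l"
    and ear_bound: "\<And>x' y' X. x' < k \<Longrightarrow> ear X x' y' \<Longrightarrow> y' \<le> l"
    and reach: "bounded_reach l (R \<union> S)"
    unfolding growing_def by blast+
  have Pk: "P k \<in> R" and Pl: "P l \<in> S"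
    using path_on_ends[OF R] path_on_ends[OF S] by simp_all
  \<comment> \<open>Beyond index \<open>k\<close>, the only vertex of \<open>P\<close> on either
    path is \<open>P l\<close>, so \<open>R\<close> can follow \<open>P\<close> anywhere short of
    \<open>P l\<close>.\<close>
  have advance: "path_on E (R \<union> P ` {k..j}) (P s) (P j)" "(R \<union> P ` {k..j}) \<inter> S = {}"
    if j: "k \<le> j" "j < l" for j
  proof -
    have "R \<inter> P ` {k..j} = {P k}"
    proof -
      have "i = k" if "i \<in> {k..j}" "P i \<in> R" for i
      proof -
        have "P l \<notin> R" using Pl RS by auto
        then have "i \<noteq> l" using that(2) by auto
        then show ?thesis using idx[of i] that j ord by auto
      qed
      then show ?thesis using Pk j(1) by force
    qed
    then show "path_on E (R \<union> P ` {k..j}) (P s) (P j)"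
      using path_on_join[OF R segment[of k j]] j ord(4) by simp
    have "P i \<notin> S" if "i \<in> {k..j}" for i
    proof
      assume "P i \<in> S"
      then have "i \<noteq> k" using Pk RS by auto
      then show False using idx[of i] \<open>P i \<in> S\<close> that j ord by auto
    qed
    then show "(R \<union> P ` {k..j}) \<inter> S = {}" using RS by auto
  qed
  show ?case
  proof (cases "b < l")
    case True
    have "linkage x a b l"
      unfolding linkage_def
    proof (intro exI conjI allI impI)
      show "{s, s'} = {x, a}" by (rule ss)
      show "path_on E (R \<union> P ` {k..b}) (P s) (P b)" "(R \<union> P ` {k..b}) \<inter> S = {}"
        using advance True less.prems(2) by auto
      show "path_on E S (P s') (P l)" by (rule S)
      fix i assume i: "i \<le> n" "P i \<in> R \<union> P ` {k..b} \<union> S"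
      show "i = x \<or> a \<le> i \<and> i \<le> b \<or> i = l"
      proof (cases "P i \<in> R \<union> S")
        case True
        then show ?thesis using idx[OF i(1)] less.prems(2) by auto
      next
        case False
        with i(2) obtain j where "j \<in> {k..b}" "P i = P j" by auto
        then have "i \<in> {k..b}" using i(1) assms(3) by auto
        then show ?thesis using ord(2) by auto
      qed
    qed
    with True ord(4) show ?thesis by blast
  next
    case False
    then have l: "0 < l" "l < n" using ord(3) assms(3) by auto
    obtain y' y Q where Q: "y' < l" "l < y" "ear Q y' y"
      and Qmax: "\<And>x' z Q'. x' < l \<Longrightarrow> ear Q' x' z \<Longrightarrow> z \<le> y" and Qreach: "bounded_reach y Q"
      using maximal_ear[OF l] by blast
    have Qp: "path_on E Q (P y') (P y)" "y \<le> n" and Qi: "\<And>i. i \<le> n \<Longrightarrow> P i \<in> Q \<Longrightarrow> i = y' \<or> i = y"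
      using Q(3) by (auto simp: ear_def)
    \<comment> \<open>An ear starting before \<open>k\<close> ends at \<open>l\<close> or earlier,
      whereas \<open>Q\<close> ends beyond \<open>l\<close>.\<close>
    have ky': "k \<le> y'" using ear_bound[OF _ Q(3)] Q(2) by force
    note adv = advance[OF ky' Q(1)]
    \<comment> \<open>Otherwise the rest of \<open>Q\<close> leads from \<open>w\<close> to
      \<open>P y\<close> with \<open>y > l\<close>, against \<open>reach\<close>.\<close>
    have old: "w \<notin> Q" if "w \<in> R \<union> S" "w \<notin> P ` {..n}" for w
    proof
      assume "w \<in> Q"
      obtain Q1 Q2 where Q12: "path_on E Q1 (P y') w" "path_on E Q2 w (P y)" "Q1 \<union> Q2 = Q" "Q1 \<inter> Q2 = {w}"
        using path_on_split[OF Qp(1) \<open>w \<in> Q\<close>] by blast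
      have "P y' \<noteq> w" using that(2) Q(1) l(2) by auto
      then have "P y' \<notin> Q2" using Q12 path_on_ends[OF Q12(1)] by blast
      then have "\<forall>i\<le>n. P i \<in> Q2 \<longrightarrow> i = y" using Qi Q12(3) by blast
      then have "y \<le> l" using reach that Qp(2) Q12(2) unfolding bounded_reach_def by blast
      then show False using Q(2) by simp
    qed
    let ?R = "R \<union> P ` {k..y'}"
    have Ridx: "i = x \<or> a \<le> i \<and> i \<le> y' \<or> i = l" if "i \<le> n" "P i \<in> ?R \<union> S" for i
    proof (cases "P i \<in> R \<union> S")
      case True
      then show ?thesis using idx[OF that(1)] ky' by auto
    next
      case False
      with that(2) obtain j where "j \<in> {k..y'}" "P i = P j" by auto
      then have "i \<in> {k..y'}" using that(1) Q(1) l(2) by auto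
      then show ?thesis using ord(2) by auto
    qed
    have RSQ: "i = y'" if "i \<le> n" "P i \<in> ?R \<union> S" "P i \<in> Q" for i
      using Ridx[OF that(1,2)] Qi[OF that(1,3)] Q(1,2) ord(1,2) ky' by auto
    have meet: "w = P y'" if "w \<in> ?R \<union> S" "w \<in> Q" for w
    proof (cases "w \<in> P ` {..n}")
      case True
      then show ?thesis using RSQ that by auto
    next
      case False
      have "w \<in> R \<union> S" using that(1) False Q(1) l(2) by auto
      then show ?thesis using old False that(2) by blast
    qed
    have Py': "P y' \<in> ?R" "P y' \<in> Q" using ky' path_on_ends[OF Qp(1)] by auto
    \<comment> \<open>The roles are exchanged: \<open>S\<close> now lags, and the extended
      \<open>R\<close> leads with its end at \<open>P y\<close>.\<close>
    have "growing x a s' s l y S (?R \<union> Q)"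
      unfolding growing_def
    proof (intro conjI allI impI)
      show "{s', s} = {x, a}" using ss by auto
      show "x < a" "a \<le> l" using ord by auto
      show "l < y" "y \<le> n" using Q Qp by auto
      show "path_on E S (P s') (P l)" by (rule S)
      show "path_on E (?R \<union> Q) (P s) (P y)"
        by (rule path_on_join[OF adv(1) Qp(1)]) (use meet Py' in blast)
      show "S \<inter> (?R \<union> Q) = {}" using adv(2) meet Py' by blast
      show "i = x \<or> a \<le> i \<and> i \<le> l \<or> i = y" if "i \<le> n" "P i \<in> S \<union> (?R \<union> Q)" for i
      proof (cases "P i \<in> ?R \<union> S")
        case True
        then show ?thesis using Ridx[OF that(1)] Q(1) ord by auto
      next
        case False
        then show ?thesis using Qi[OF that(1)] that(2) ord ky' Q(1) by auto
      qed
      show "y2 \<le> y" if "x' < l" "ear X x' y2" for x' y2 X using Qmax that by blast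
      have "S \<union> (?R \<union> Q) - P ` {..n} \<subseteq> (R \<union> S) \<union> Q" using Q(1) l(2) by auto
      then show "bounded_reach y (S \<union> (?R \<union> Q))"
        using bounded_reach_subset_Un[OF bounded_reach_mono[OF reach] Qreach] Q(2) by simp
    qed
    moreover have "n - y < n - l" using Q(2) l(2) by simp
    ultimately show ?thesis using less.hyps False by simp
  qed
qed

lemma linkage_exists:
  assumes "0 < a" "a \<le> b" "b < n"
  obtains x l where "x < a" "b < l" "l \<le> n" "linkage x a b l"
proof -
  obtain x l Q where Q: "x < a" "a < l" "ear Q x l"
    and Qmax: "\<And>x' z Q'. x' < a \<Longrightarrow> ear Q' x' z \<Longrightarrow> z \<le> l" and Qreach: "bounded_reach l Q"
    using maximal_ear[of a] assms by auto
  \<comment> \<open>The initial lagging path is the single vertex \<open>P a\<close>; the leading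
    one is a maximal ear over it.\<close>
  have "growing x a a x a l {P a} Q"
    unfolding growing_def
  proof (intro conjI allI impI)
    show "l \<le> n" "path_on E Q (P x) (P l)" using Q(3) by (auto simp: ear_def)
    have "P a \<notin> Q" using Q assms unfolding ear_def by (metis less_imp_le_nat less_irrefl order_trans)
    then show "{P a} \<inter> Q = {}" by simp
    show "i = x \<or> a \<le> i \<and> i \<le> a \<or> i = l" if "i \<le> n" "P i \<in> {P a} \<union> Q" for i
    proof (cases "P i = P a")
      case True
      then show ?thesis using that(1) assms by simp
    next
      case False
      then show ?thesis using that Q(3) unfolding ear_def by blast
    qed
    show "y' \<le> l" if "x' < a" "ear X x' y'" for x' y' X using Qmax that by blast
    have "{P a} \<union> Q - P ` {..n} \<subseteq> Q \<union> Q" using assms by auto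
    then show "bounded_reach l ({P a} \<union> Q)" by (rule bounded_reach_subset_Un[OF Qreach Qreach])
    show "path_on E {P a} (P a) (P a)" by (rule path_on.single)
    show "{a, x} = {x, a}" by auto
    show "x < a" "a < l" by (rule Q)+
    show "a \<le> a" by simp
  qed
  then obtain l' where "b < l'" "l' \<le> n" "linkage x a b l'"
    using linkage_of_growing[OF _ assms(2,3)] by blast
  with Q(1) show ?thesis by (rule that)
qed

section \<open>Long cycles from the ends of a path\<close>

lemma card_indices:
  assumes "{v. E u v} \<subseteq> P ` {..n}"
  shows "card {i. i \<le> n \<and> E u (P i)} = card {v. E u v}"
proof -
  have "P ` {i. i \<le> n \<and> E u (P i)} = {v. E u v}" using assms by auto
  moreover have "inj_on P {i. i \<le> n \<and> E u (P i)}" by (rule inj_on_subset[OF inj]) auto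
  ultimately show ?thesis using card_image by metis
qed

lemma card_image_P: "I \<subseteq> {..n} \<Longrightarrow> card (P ` I) = card I"
  using card_image inj_on_subset inj by metis

text \<open>The cycle runs from \<open>P i\<close> back to \<open>P 0\<close>, over to
  \<open>P j\<close>, on to \<open>P n\<close> and back to \<open>P i\<close>, so it omits only the
  \<open>j - i - 1\<close> vertices in between.\<close>

lemma long_cycle_crossing:
  assumes "i \<le> n" "E (P n) (P i)" "j \<le> n" "E (P 0) (P j)" "i < j"
  shows "\<exists>X u v. path_on E X u v \<and> E v u \<and>
    min (n + 1) (card {v. E (P 0) v} + card {v. E (P n) v}) \<le> card X"
proof -
  let ?A = "{i. i \<le> n \<and> E (P 0) (P i)}" and ?B = "{i. i \<le> n \<and> E (P n) (P i)}"
  let ?cross = "\<lambda>d. \<exists>i\<in>?B. \<exists>j\<in>?A. i < j \<and> j - i = d"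
  define d where "d = (LEAST d. ?cross d)"
  have "?cross (j - i)" using assms by blast
  then have "?cross d" unfolding d_def by (rule LeastI)
  then obtain i j where ij: "i \<in> ?B" "j \<in> ?A" "i < j" "j - i = d" by blast
  have min: "j - i \<le> j' - i'" if "i' \<in> ?B" "j' \<in> ?A" "i' < j'" for i' j'
    unfolding ij(4) d_def by (rule Least_le) (use that in blast)
  have "path_on E (P ` {0..i}) (P i) (P 0)" "path_on E (P ` {j..n}) (P j) (P n)"
    using ij by (auto intro: segment segment_rev)
  moreover have "E (P 0) (P j)" using ij by simp
  moreover have "P ` {0..i} \<inter> P ` {j..n} = {}" using ij by auto
  ultimately have path: "path_on E (P ` {0..i} \<union> P ` {j..n}) (P i) (P n)"
    by (intro path_on_bridge)
  have "card (P ` {0..i} \<union> P ` {j..n}) = card ({0..i} \<union> {j..n})"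
    unfolding image_Un[symmetric] using ij by (intro card_image_P) auto
  also have "\<dots> = (i + 1) + (n + 1 - j)" using ij by (subst card_Un_disjoint) auto
  finally have card: "card (P ` {0..i} \<union> P ` {j..n}) = (i + 1) + (n + 1 - j)" .
  have "min (n + 1) (card ?A + card ?B) \<le> (i + 1) + (n + 1 - j)"
  proof (cases "j = Suc i")
    case True
    then show ?thesis using ij by simp
  next
    case False
    \<comment> \<open>A common index would be a crossing pair at distance 1, but the least distance
      \<open>j - i\<close> is larger.\<close>
    have "?A \<inter> Suc ` ?B = {}" using min ij(3) False by fastforce
    then have "card ?A + card ?B = card (?A \<union> Suc ` ?B)"
      by (subst card_Un_disjoint) (auto simp: card_image)
    \<comment> \<open>By minimality no neighbour of either end has its index strictly between
      \<open>i\<close> and \<open>j\<close>. The first interval extends to \<open>Suc i\<close> to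
      hold the successor of \<open>i\<close>; together the intervals have as many elements as the
      cycle has vertices.\<close>
    also have "\<dots> \<le> card ({1..Suc i} \<union> {j..n})"
    proof (rule card_mono)
      have "k \<in> {1..Suc i} \<union> {j..n}" if "k \<in> ?A" for k
      proof -
        have "k \<noteq> 0" using that irrefl by (cases k) auto
        then show ?thesis using that min[OF ij(1) that] ij(3) by (cases "i < k") auto
      qed
      moreover have "Suc k \<in> {1..Suc i} \<union> {j..n}" if "k \<in> ?B" for k
      proof -
        have "k \<noteq> n" using that irrefl by auto
        then show ?thesis using that min[OF that ij(2)] ij(3) by (cases "k < j") auto
      qed
      ultimately show "?A \<union> Suc ` ?B \<subseteq> {1..Suc i} \<union> {j..n}" by blast
    qed simp
    also have "\<dots> = (i + 1) + (n + 1 - j)" using ij False by (subst card_Un_disjoint) auto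
    finally show ?thesis by simp
  qed
  moreover have "card ?A = card {v. E (P 0) v}" "card ?B = card {v. E (P n) v}"
    using first_nbrs last_nbrs by (auto intro!: card_indices)
  ultimately show ?thesis using path card ij(1) by (intro exI[of _ "P ` {0..i} \<union> P ` {j..n}"]) auto
qed

text \<open>The cycle consists of a path through the left part of \<open>P\<close> containing
  \<open>P 0\<close> and all its neighbours, a similar path on the right, and the two linking paths.
  The two closed neighbourhoods share at most \<open>P b\<close>, which gives the
  \<open>+ 1\<close>.\<close>

lemma long_cycle_linked:
  assumes nocross: "\<And>i j. i \<le> n \<Longrightarrow> E (P n) (P i) \<Longrightarrow> j \<le> n \<Longrightarrow> E (P 0) (P j) \<Longrightarrow> j \<le> i"
    and "0 < n"
  shows "\<exists>X u v. path_on E X u v \<and> E v u \<and>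
    card {v. E (P 0) v} + card {v. E (P n) v} + 1 \<le> card X"
proof -
  define A where "A = {i. i \<le> n \<and> E (P 0) (P i)}"
  define B where "B = {i. i \<le> n \<and> E (P n) (P i)}"
  have fin: "finite A" "finite B" unfolding A_def B_def by auto
  have "1 \<in> A" "n - 1 \<in> B"
    using PE[of 0] E_sym[OF PE[of "n - 1"]] \<open>0 < n\<close> by (auto simp: A_def B_def)
  then have ne: "A \<noteq> {}" "B \<noteq> {}" by auto
  have "0 \<notin> A" "n \<notin> B" using irrefl by (auto simp: A_def B_def)
  define a where "a = Max A"
  define b where "b = Min B"
  have a: "a \<in> A" "\<And>i. i \<in> A \<Longrightarrow> i \<le> a" unfolding a_def using fin ne by auto
  have b: "b \<in> B" "\<And>i. i \<in> B \<Longrightarrow> b \<le> i" unfolding b_def using fin ne by auto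
  have "a \<le> b" using nocross a(1) b(1) unfolding A_def B_def by blast
  have "a \<noteq> 0" using a(1) \<open>0 \<notin> A\<close> by metis
  have "b \<noteq> n" using b(1) \<open>n \<notin> B\<close> by metis
  then have "b < n" using b(1) unfolding B_def by simp
  obtain x l where xl: "x < a" "b < l" "l \<le> n" and link: "linkage x a b l"
    using linkage_exists[OF _ \<open>a \<le> b\<close> \<open>b < n\<close>] \<open>a \<noteq> 0\<close> by blast
  obtain s s' R S where ss: "{s, s'} = {x, a}" and R: "path_on E R (P s) (P b)"
    and S: "path_on E S (P s') (P l)" and RS: "R \<inter> S = {}"
    and idx: "\<And>i. i \<le> n \<Longrightarrow> P i \<in> R \<union> S \<Longrightarrow> i = x \<or> a \<le> i \<and> i \<le> b \<or> i = l"
    using link unfolding linkage_def by blast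
  \<comment> \<open>\<open>y\<close> is the first neighbour index of \<open>P 0\<close> after
    \<open>x\<close>, and \<open>z\<close> the last one of \<open>P n\<close> before
    \<open>l\<close>. Skipping the vertices between \<open>x\<close> and \<open>y\<close>, or
    between \<open>z\<close> and \<open>l\<close>, loses no neighbour of the end concerned.\<close>
  define y where "y = Min {j \<in> A. x < j}"
  define z where "z = Max {i \<in> B. i < l}"
  have "y \<in> {j \<in> A. x < j}" unfolding y_def using fin a(1) xl(1) by (intro Min_in) auto
  then have y: "y \<in> A" "x < y" by auto
  have ymin: "y \<le> j" if "j \<in> A" "x < j" for j unfolding y_def using fin that by (intro Min_le) auto
  have "z \<in> {i \<in> B. i < l}" unfolding z_def using fin b(1) xl(2) by (intro Max_in) auto
  then have z: "z \<in> B" "z < l" by auto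
  have zmax: "i \<le> z" if "i \<in> B" "i < l" for i unfolding z_def using fin that by (intro Max_ge) auto
  have ya: "y \<le> a" and bz: "b \<le> z" using y z a b by auto
  note ord = xl y(2) z(2) ya bz \<open>a \<le> b\<close> \<open>b < n\<close>

  \<comment> \<open>\<open>I\<close> is traversed from \<open>x\<close> down to 0, then from
    \<open>y\<close> up to \<open>a\<close>; \<open>J\<close> from \<open>l\<close> up to
    \<open>n\<close>, then from \<open>z\<close> down to \<open>b\<close>.\<close>
  define I where "I = {0..x} \<union> {y..a}"
  define J where "J = {l..n} \<union> {b..z}"
  have IJn: "I \<subseteq> {..n}" "J \<subseteq> {..n}" using ord by (auto simp: I_def J_def)
  have D: "path_on E (P ` I) (P x) (P a)"
    unfolding I_def image_Un
  proof (rule path_on_bridge)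
    show "path_on E (P ` {0..x}) (P x) (P 0)" "path_on E (P ` {y..a}) (P y) (P a)"
      using ord by (auto intro: segment segment_rev)
    show "E (P 0) (P y)" using y(1) by (simp add: A_def)
    show "P ` {0..x} \<inter> P ` {y..a} = {}" using ord by auto
  qed
  have U: "path_on E (P ` J) (P l) (P b)"
    unfolding J_def image_Un
  proof (rule path_on_bridge)
    show "path_on E (P ` {l..n}) (P l) (P n)" "path_on E (P ` {b..z}) (P z) (P b)"
      using ord by (auto intro: segment segment_rev)
    show "E (P n) (P z)" using z(1) by (simp add: B_def)
    show "P ` {l..n} \<inter> P ` {b..z} = {}" using ord by auto
  qed
  \<comment> \<open>The path through \<open>I\<close> is reversed if necessary, so that it leads
    from the start of \<open>R\<close> to the start of \<open>S\<close>.\<close>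
  have "s = x \<and> s' = a \<or> s = a \<and> s' = x" using ss by (simp add: doubleton_eq_iff)
  then have D': "path_on E (P ` I) (P s) (P s')" using D path_on_rev[OF D symE] by auto
  have ends: "P s \<in> R" "P b \<in> R" "P s' \<in> S" "P l \<in> S" "P s \<in> P ` I" "P s' \<in> P ` I" "P b \<in> P ` J" "P l \<in> P ` J"
    using path_on_ends[OF R] path_on_ends[OF S] path_on_ends[OF D'] path_on_ends[OF U] by auto
  have meetI: "i = s \<or> i = s'" if "i \<in> I" "P i \<in> R \<union> S" for i
  proof -
    have "i \<le> n" using that(1) IJn by auto
    from idx[OF this that(2)] have "i = x \<or> i = a" using that(1) ord by (auto simp: I_def)
    with ss show ?thesis by auto
  qed
  have meetJ: "i = b \<or> i = l" if "i \<in> J" "P i \<in> R \<union> S" for i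
  proof -
    have "i \<le> n" using that(1) IJn by auto
    from idx[OF this that(2)] show ?thesis using that(1) ord by (auto simp: J_def)
  qed
  have RI: "R \<inter> P ` I = {P s}" using meetI ends RS by blast
  have SI: "S \<inter> P ` I = {P s'}" using meetI ends RS by blast
  have RJ: "R \<inter> P ` J = {P b}" using meetJ ends RS by blast
  have SJ: "S \<inter> P ` J = {P l}" using meetJ ends RS by blast
  \<comment> \<open>The two index sets can overlap only if \<open>a = b\<close>.\<close>
  have IJ: "P ` I \<inter> P ` J \<subseteq> {P b}"
  proof
    fix w assume "w \<in> P ` I \<inter> P ` J"
    then obtain i where i: "w = P i" "i \<in> I" "P i \<in> P ` J" by auto
    then obtain j where j: "P i = P j" "j \<in> J" by auto
    have "i \<le> n" "j \<le> n" using i(2) j(2) IJn by auto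
    then have "i = j" using j(1) by simp
    then have "i = b" using i(2) j(2) ord by (auto simp: I_def J_def)
    then show "w \<in> {P b}" using i(1) by simp
  qed
  have "path_on E (R \<union> P ` I) (P b) (P s')"
    by (rule path_on_join[OF path_on_rev[OF R symE] D' RI])
  moreover have "(R \<union> P ` I) \<inter> S = {P s'}" using RS SI by blast
  ultimately have "path_on E (R \<union> P ` I \<union> S) (P b) (P l)"
    using path_on_join S by metis
  moreover have "(R \<union> P ` I \<union> S) \<inter> P ` J = {P b, P l}" using RJ SJ IJ by blast
  moreover have "P b \<noteq> P l" using xl \<open>b < n\<close> by simp
  ultimately obtain w where w: "path_on E (R \<union> P ` I \<union> S \<union> P ` J) (P b) w" "E w (P b)"
    using path_on_close[OF symE _ U] by blast

  have A_I: "insert 0 A \<subseteq> I"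
  proof -
    have "i \<in> I" if "i \<in> A" for i
      using ymin[OF that] a(2)[OF that] by (cases "x < i") (auto simp: I_def)
    moreover have "0 \<in> I" by (simp add: I_def)
    ultimately show ?thesis by blast
  qed
  have B_J: "insert n B \<subseteq> J"
  proof -
    have "i \<in> J" if "i \<in> B" for i
      using zmax[OF that] b(2)[OF that] that by (cases "i < l") (auto simp: J_def B_def)
    moreover have "n \<in> J" using xl by (simp add: J_def)
    ultimately show ?thesis by blast
  qed
  have finIJ: "finite I" "finite J" by (auto simp: I_def J_def)
  have "I \<inter> J \<subseteq> {b}" using ord by (auto simp: I_def J_def)
  then have "insert 0 A \<inter> insert n B \<subseteq> {b}" using A_I B_J by blast
  then have "card (insert 0 A \<inter> insert n B) \<le> 1"
    using card_mono[of "{b}"] by fastforce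
  moreover have "card (insert 0 A) = card A + 1" "card (insert n B) = card B + 1"
    using fin \<open>0 \<notin> A\<close> \<open>n \<notin> B\<close> by auto
  moreover have "card (insert 0 A \<union> insert n B) + card (insert 0 A \<inter> insert n B) =
      card (insert 0 A) + card (insert n B)"
    using fin by (intro card_Un_Int[symmetric]) auto
  moreover have "card (insert 0 A \<union> insert n B) \<le> card (I \<union> J)"
    using A_I B_J finIJ by (intro card_mono) auto
  moreover have "card (I \<union> J) = card (P ` (I \<union> J))" using IJn by (simp add: card_image_P)
  moreover have "card (P ` (I \<union> J)) \<le> card (R \<union> P ` I \<union> S \<union> P ` J)"
    using path_on_finite[OF w(1)] by (intro card_mono) auto
  moreover have "card A = card {v. E (P 0) v}" "card B = card {v. E (P n) v}"
    unfolding A_def B_def using first_nbrs last_nbrs by (auto intro!: card_indices)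
  ultimately have "card {v. E (P 0) v} + card {v. E (P n) v} + 1 \<le> card (R \<union> P ` I \<union> S \<union> P ` J)"
    by linarith
  with w show ?thesis by blast
qed

lemma long_cycle:
  assumes "0 < n"
  shows "\<exists>X u v. path_on E X u v \<and> E v u \<and>
    min (n + 1) (card {v. E (P 0) v} + card {v. E (P n) v}) \<le> card X"
proof (cases "\<exists>i j. i \<le> n \<and> E (P n) (P i) \<and> j \<le> n \<and> E (P 0) (P j) \<and> i < j")
  case True
  then show ?thesis using long_cycle_crossing by blast
next
  case False
  then obtain X u v where "path_on E X u v" "E v u"
    and "card {v. E (P 0) v} + card {v. E (P n) v} + 1 \<le> card X"
    using long_cycle_linked[OF _ assms] by (metis not_less)
  then show ?thesis by (intro exI[of _ X] exI[of _ u] exI[of _ v]) auto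
qed

end

section \<open>Longest paths and rotations\<close>

context two_connected_relation
begin

text \<open>\<open>u \<in> V\<close> is demanded because \<open>path_on.single\<close> also gives
  one-vertex paths outside \<open>V\<close>.\<close>

definition longest_path_on :: "'a set \<Rightarrow> 'a \<Rightarrow> 'a \<Rightarrow> bool" where
  "longest_path_on X u v \<longleftrightarrow> path_on E X u v \<and> u \<in> V \<and>
     (\<forall>Y u' v'. path_on E Y u' v' \<longrightarrow> u' \<in> V \<longrightarrow> card Y \<le> card X)"

lemma longest_path_on_ge: "longest_path_on X u v \<Longrightarrow> path_on E Y u' v' \<Longrightarrow> u' \<in> V \<Longrightarrow> card Y \<le> card X"
  unfolding longest_path_on_def by blast

lemma longest_path_on_subset: "longest_path_on X u v \<Longrightarrow> X \<subseteq> V"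
  unfolding longest_path_on_def using path_on_subset[of E X u v V] EV by blast

lemma longest_path_on_rev: "longest_path_on X u v \<Longrightarrow> longest_path_on X v u"
  using longest_path_on_subset[of X u v] path_on_ends[of E X u v] path_on_rev[of E X u v] symE
  unfolding longest_path_on_def by blast

lemma longest_path_on_nbrs:
  assumes "longest_path_on X u v" "E u w"
  shows "w \<in> X"
proof (rule ccontr)
  assume "w \<notin> X"
  moreover have "path_on E X u v" using assms(1) longest_path_on_def by blast
  ultimately have "path_on E (insert w X) w v" using E_sym[OF assms(2)] by (intro path_on.step)
  then have "card (insert w X) \<le> card X"
    using assms(1) EV[OF assms(2)] unfolding longest_path_on_def by blast
  with \<open>w \<notin> X\<close> path_on_finite[OF \<open>path_on E X u v\<close>] show False by simp
qed

text \<open>The path has at least three vertices because its end \<open>u\<close> and the two or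
  more neighbours of \<open>u\<close> all lie on it.\<close>

lemma longest_path_on_enumeration:
  assumes "longest_path_on X u v"
  obtains P n where "2 \<le> n" "card X = n + 1" "path_in_two_connected E V P n" "P ` {..n} = X" "P 0 = u" "P n = v"
proof -
  have X: "path_on E X u v" "u \<in> V" using assms longest_path_on_def by blast+
  have fin: "finite X" using path_on_finite[OF X(1)] .
  have "insert u {w. E u w} \<subseteq> X" using longest_path_on_nbrs[OF assms] path_on_ends[OF X(1)] by auto
  then have "card (insert u {w. E u w}) \<le> card X" using fin by (rule card_mono[rotated])
  then have card: "3 \<le> card X" using degree_ge_2[OF X(2)] irrefl by simp
  define n where "n = card X - 1"
  have n: "card X = n + 1" "2 \<le> n" "{..<card X} = {..n}" using card by (auto simp: n_def)
  obtain P where P: "inj_on P {..<card X}" "P ` {..<card X} = X" "P 0 = u" "P (card X - 1) = v"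
    "\<And>i. Suc i < card X \<Longrightarrow> E (P i) (P (Suc i))"
    using path_on_enumeration[OF X(1)] by blast
  have "path_in_two_connected E V P n"
  proof unfold_locales
    show "inj_on P {..n}" using P(1) n by simp
    show "E (P i) (P (Suc i))" if "i < n" for i using P(5) that n by simp
    show "P 0 \<in> V" using P(3) X(2) by simp
    show "w \<in> P ` {..n}" if "E (P 0) w" for w
      using longest_path_on_nbrs[OF assms] that P(2,3) n(3) by simp
    show "w \<in> P ` {..n}" if "E (P n) w" for w
      using longest_path_on_nbrs[OF longest_path_on_rev[OF assms]] that P(2,4) n(1,3) by simp
  qed
  then show ?thesis using that[of n P] n P by simp
qed

lemma longest_path_on_cycle:
  assumes "longest_path_on X u v"
  shows "\<exists>Y u' v'. path_on E Y u' v' \<and> E v' u' \<and> 3 \<le> card Y \<and>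
    min (card X) (card {w. E u w} + card {w. E v w}) \<le> card Y"
proof -
  obtain P n where P: "2 \<le> n" "card X = n + 1" "P ` {..n} = X" "P 0 = u" "P n = v"
    and loc: "path_in_two_connected E V P n"
    using longest_path_on_enumeration[OF assms] by metis
  interpret path_in_two_connected E V P n by (rule loc)
  obtain Y u' v' where Y: "path_on E Y u' v'" "E v' u'"
    "min (n + 1) (card {w. E u w} + card {w. E v w}) \<le> card Y"
    using long_cycle P by auto
  \<comment> \<open>With \<open>2 \<le> n\<close> this excludes the degenerate cycle that runs along
    one edge and back.\<close>
  have "2 \<le> card {w. E u w}" "2 \<le> card {w. E v w}"
    using degree_ge_2 P_in_V[of 0] P_in_V[of n] P by auto
  with Y(3) P(1) have "3 \<le> card Y" by auto
  with Y P(2) show ?thesis by auto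
qed

text \<open>Rotation in the sense of Posa: if \<open>P (Suc i)\<close> is a neighbour of
  \<open>P 0\<close>, reversing the initial segment up to \<open>P i\<close> gives a path on the
  same vertices from \<open>P i\<close> to \<open>v\<close>. Distinct neighbours yield distinct new
  ends.\<close>

lemma rotation:
  assumes "longest_path_on X u v"
  obtains W where "card W = card {w. E u w}" "W \<subseteq> X - {v}" "\<And>w. w \<in> W \<Longrightarrow> longest_path_on X w v"
proof -
  obtain P n where P: "2 \<le> n" "card X = n + 1" "P ` {..n} = X" "P 0 = u" "P n = v"
    and loc: "path_in_two_connected E V P n"
    using longest_path_on_enumeration[OF assms] by metis
  interpret path_in_two_connected E V P n by (rule loc)
  \<comment> \<open>\<open>i < n\<close> keeps the fixed end \<open>P n\<close> out of the new ends.
    The shift loses no neighbour, as \<open>P 0\<close> is not adjacent to itself.\<close>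
  let ?I = "{i. i < n \<and> E (P 0) (P (Suc i))}"
  have "Suc ` ?I = {i. i \<le> n \<and> E (P 0) (P i)}"
  proof (intro equalityI subsetI)
    fix i assume "i \<in> {i. i \<le> n \<and> E (P 0) (P i)}"
    then show "i \<in> Suc ` ?I" using irrefl by (cases i) auto
  qed auto
  then have "card ?I = card {i. i \<le> n \<and> E (P 0) (P i)}"
    using card_image[of Suc ?I] by simp
  moreover have "\<dots> = card {w. E (P 0) w}" using first_nbrs by (intro card_indices) auto
  moreover have "?I \<subseteq> {..n}" by auto
  ultimately have "card (P ` ?I) = card {w. E u w}" using card_image_P[of ?I] P(4) by simp
  moreover have "P ` ?I \<subseteq> X - {v}" using P by auto
  moreover have "longest_path_on X w v" if w: "w \<in> P ` ?I" for w
  proof -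
    obtain i where i: "w = P i" "i < n" "E (P 0) (P (Suc i))" using w by blast
    have "path_on E (P ` {0..i} \<union> P ` {Suc i..n}) (P i) (P n)"
    proof (rule path_on_bridge)
      show "path_on E (P ` {0..i}) (P i) (P 0)" "path_on E (P ` {Suc i..n}) (P (Suc i)) (P n)"
        using i by (auto intro: segment segment_rev)
      show "E (P 0) (P (Suc i))" by (rule i)
      show "P ` {0..i} \<inter> P ` {Suc i..n} = {}" using i by auto
    qed
    moreover have "{0..i} \<union> {Suc i..n} = {..n}" using i by auto
    then have "P ` {0..i} \<union> P ` {Suc i..n} = X" using P(3) by (simp flip: image_Un)
    ultimately have "path_on E X w v" using i P by simp
    moreover have "w \<in> V" using P_in_V i by simp
    ultimately show ?thesis using assms unfolding longest_path_on_def by blast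
  qed
  ultimately show ?thesis using that by blast
qed

lemma longest_path_on_exists: "\<exists>X u v. longest_path_on X u v"
proof -
  have "V \<noteq> {}" using card_V by auto
  then obtain v where "v \<in> V" by auto
  let ?S = "{X. \<exists>u v. path_on E X u v \<and> u \<in> V}"
  have "?S \<subseteq> Pow V" using path_on_subset[of E _ _ _ V] EV by blast
  then have fin: "finite ?S" using finite_subset[OF _ finite_Pow_iff[THEN iffD2, OF finite_V]] by simp
  have "{v} \<in> ?S" using path_on.single \<open>v \<in> V\<close> by fast
  then have "Max (card ` ?S) \<in> card ` ?S" using fin by (intro Max_in) auto
  then obtain X u v where X: "path_on E X u v" "u \<in> V" "card X = Max (card ` ?S)" by auto
  have "card Y \<le> card X" if "path_on E Y u' v'" "u' \<in> V" for Y u' v'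
    unfolding X(3) using fin that by (intro Max_ge) auto
  with X(1,2) show ?thesis unfolding longest_path_on_def by blast
qed

text \<open>\<open>a\<close> and \<open>b\<close> stand for the terms of the degree sequence with
  indices \<open>\<delta>\<close> and \<open>\<delta> + 1\<close>; all that is assumed of them is
  what they guarantee in a vertex set of that size.\<close>

lemma cycle_ge_degrees:
  assumes min_deg: "\<And>v. v \<in> V \<Longrightarrow> \<delta> \<le> card {w. E v w}"
    and a: "\<And>W. W \<subseteq> V \<Longrightarrow> \<delta> \<le> card W \<Longrightarrow> \<exists>v\<in>W. a \<le> card {w. E v w}"
    and b: "\<And>W. W \<subseteq> V \<Longrightarrow> \<delta> + 1 \<le> card W \<Longrightarrow> \<exists>v\<in>W. b \<le> card {w. E v w}"
  shows "\<exists>X u v Y u' v'. longest_path_on X u v \<and> path_on E Y u' v' \<and> E v' u' \<and> 3 \<le> card Y \<and>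
    min (card X) (a + b) \<le> card Y"
proof -
  obtain X u v where X: "longest_path_on X u v" using longest_path_on_exists by blast
  have XV: "X \<subseteq> V" using longest_path_on_subset[OF X] .
  obtain W where W: "card W = card {w. E u w}" "W \<subseteq> X - {v}" "\<And>w. w \<in> W \<Longrightarrow> longest_path_on X w v"
    using rotation[OF X] by blast
  have "u \<in> V" using X longest_path_on_def by blast
  then obtain x where x: "x \<in> W" "a \<le> card {w. E x w}"
    using a[of W] W(1,2) XV min_deg[of u] by auto
  have Xvx: "longest_path_on X v x" using W(3)[OF x(1)] by (rule longest_path_on_rev)
  obtain W' where W': "card W' = card {w. E v w}" "W' \<subseteq> X - {x}" "\<And>w. w \<in> W' \<Longrightarrow> longest_path_on X w x"
    using rotation[OF Xvx] by blast
  have "v \<in> V" using Xvx longest_path_on_def by blast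
  have xV: "x \<in> V" using x W XV by auto
  have W'V: "W' \<subseteq> V" using W'(2) XV by auto
  then have "finite W'" using finite_V by (rule finite_subset)
  have "x \<notin> W'" using W'(2) by auto
  then have "\<delta> + 1 \<le> card (insert x W')" using \<open>finite W'\<close> W'(1) min_deg[OF \<open>v \<in> V\<close>] by simp
  then obtain y where y: "y \<in> insert x W'" "b \<le> card {w. E y w}" using b[of "insert x W'"] W'V xV by auto
  \<comment> \<open>This covers the case that \<open>y\<close> is \<open>x\<close> itself: then
    \<open>x\<close> supplies \<open>b\<close> and \<open>y'\<close> supplies \<open>a\<close>.
    Otherwise \<open>y\<close> lies in \<open>W'\<close> and \<open>x\<close> supplies
    \<open>a\<close>.\<close>
  obtain y' where y': "y' \<in> W'" "a \<le> card {w. E y' w}"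
    using a[OF W'V] W'(1) min_deg[OF \<open>v \<in> V\<close>] by auto
  have "\<exists>y\<in>W'. a + b \<le> card {w. E y w} + card {w. E x w}"
  proof (cases "y = x")
    case True
    with y y' show ?thesis by (intro bexI[of _ y']) auto
  next
    case False
    with y x show ?thesis by (intro bexI[of _ y]) auto
  qed
  then obtain y where y: "y \<in> W'" "a + b \<le> card {w. E y w} + card {w. E x w}" by blast
  have long: "longest_path_on X y x" by (rule W'(3)[OF y(1)])
  obtain Y u' v' where "path_on E Y u' v'" "E v' u'" "3 \<le> card Y"
    "min (card X) (card {w. E y w} + card {w. E x w}) \<le> card Y"
    using longest_path_on_cycle[OF long] by blast
  moreover from this(4) y(2) have "min (card X) (a + b) \<le> card Y" by linarith
  ultimately show ?thesis using long by blast
qed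

end

section \<open>Transfer to graphs\<close>

text \<open>The size of \<open>S\<close> lies below the least one at which a vertex set can
  disconnect the graph or leave a single vertex.\<close>

lemma two_connected_small_separator:
  assumes "two_connected G" "S \<subseteq> verts G" "card S < 2"
  shows "connected (G \<restriction> (verts G - S))" "card (verts G - S) \<noteq> 1"
proof -
  let ?Q = "\<lambda>k. \<exists>S \<subseteq> verts G. card S = k \<and>
    (\<not> connected (G \<restriction> (verts G - S)) \<or> card (verts G - S) = 1)"
  have "card S < (LEAST k. ?Q k)"
    using assms(1,3) unfolding two_connected_def vertex_connectivity_def by simp
  then have "\<not> ?Q (card S)" by (rule not_less_Least)
  then have "\<not> (\<not> connected (G \<restriction> (verts G - S)) \<or> card (verts G - S) = 1)"
    using assms(2) by (intro notI) (elim notE, intro exI[of _ S] conjI refl)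
  then show "connected (G \<restriction> (verts G - S))" "card (verts G - S) \<noteq> 1" by simp_all
qed

text \<open>Were all degrees in \<open>W\<close> smaller, at least \<open>k\<close> entries of the
  sorted sequence would lie below its \<open>k\<close>-th term, but only the \<open>k - 1\<close>
  entries before it can.\<close>

lemma degree_term_le_degree:
  assumes "finite (verts G)" "W \<subseteq> verts G" "1 \<le> k" "k \<le> card W"
  shows "\<exists>v\<in>W. degree_term G k \<le> degree G v"
proof (rule ccontr)
  assume "\<not> ?thesis"
  then have less: "degree G v < degree_term G k" if "v \<in> W" for v using that by auto
  let ?xs = "degree_sequence G" and ?t = "degree_term G k"
  have "sorted ?xs" by (simp add: degree_sequence_def)
  have "card W \<le> card {v \<in> verts G. degree G v < ?t}"
    using less assms(1,2) by (intro card_mono) auto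
  also have "\<dots> = size (filter_mset (\<lambda>d. d < ?t) (image_mset (degree G) (mset_set (verts G))))"
    using assms(1) by (simp add: filter_mset_image_mset)
  also have "\<dots> = size (filter_mset (\<lambda>d. d < ?t) (mset ?xs))"
    by (simp add: degree_sequence_def)
  also have "\<dots> = length (filter (\<lambda>d. d < ?t) ?xs)"
    by (metis mset_filter size_mset)
  also have "\<dots> = card {i. i < length ?xs \<and> ?xs ! i < ?t}"
    by (rule length_filter_conv_card)
  also have "\<dots> \<le> card {..<k - 1}"
  proof (rule card_mono)
    show "{i. i < length ?xs \<and> ?xs ! i < ?t} \<subseteq> {..<k - 1}"
    proof
      fix i assume i: "i \<in> {i. i < length ?xs \<and> ?xs ! i < ?t}"
      have "\<not> k - 1 \<le> i"
        using sorted_nth_mono[OF \<open>sorted ?xs\<close>, of "k - 1" i] i by (auto simp: degree_term_def)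
      then show "i \<in> {..<k - 1}" by simp
    qed
  qed simp
  finally show False using assms(3,4) by simp
qed

section \<open>Translation between paths as vertex sets and walks of the digraph\<close>

lemma vpath_imp_path_on:
  assumes "vpath p G"
  shows "path_on (dominates G) (set p) (hd p) (last p)"
  using assms
proof (induction p rule: vwalk_arcs.induct)
  case 1
  then show ?case by (auto simp: vpath_def vwalk_def)
next
  case (2 x)
  show ?case using path_on.single[of _ x] by simp
next
  case (3 x y xs)
  then have "vpath (y # xs) G" "x \<rightarrow>\<^bsub>G\<^esub> y" "x \<notin> set (y # xs)"
    by (auto simp: vpath_def vwalk_def)
  with "3.IH" path_on.step[of "dominates G" x y "set (y # xs)"] show ?case by simp
qed

context graph
begin

lemma card_successors: "card {v. u \<rightarrow>\<^bsub>G\<^esub> v} = degree G u"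
proof -
  have "{v. u \<rightarrow>\<^bsub>G\<^esub> v} = head G ` out_arcs G u"
    by (auto simp: out_arcs_def arcs_ends_def arc_to_ends_def)
  moreover have "inj_on (head G) (out_arcs G u)"
    by (rule inj_onI) (auto simp: out_arcs_def arc_to_ends_def intro: no_multi_arcs)
  ultimately show ?thesis by (simp add: card_image out_degree_def)
qed

lemma path_on_imp_awalk:
  assumes "path_on (dominates G) X u v" "u \<in> verts G"
  shows "\<exists>p. awalk u p v \<and> distinct (awalk_verts u p) \<and> set (awalk_verts u p) = X"
  using assms
proof (induction rule: path_on.induct)
  case (single u)
  then show ?case by (intro exI[of _ "[]"]) (auto simp: awalk_Nil_iff)
next
  case (step u v X w)
  obtain e where e: "e \<in> arcs G" "tail G e = u" "head G e = v"
    using step.hyps(1) by (auto simp: arcs_ends_def arc_to_ends_def)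
  then obtain p where "awalk v p w" "distinct (awalk_verts v p)" "set (awalk_verts v p) = X"
    using step.IH by auto
  with e step.hyps(3) show ?case by (intro exI[of _ "e # p"]) (auto simp: awalk_Cons_iff)
qed

lemma path_on_imp_cycle:
  assumes "path_on (dominates G) X u v" "v \<rightarrow>\<^bsub>G\<^esub> u"
  shows "\<exists>p. cycle p \<and> length p = card X"
proof -
  obtain e where e: "e \<in> arcs G" "tail G e = v" "head G e = u"
    using assms(2) by (auto simp: arcs_ends_def arc_to_ends_def)
  then obtain p where p: "awalk u p v" "distinct (awalk_verts u p)" "set (awalk_verts u p) = X"
    using path_on_imp_awalk[OF assms(1)] by auto
  have "cycle (e # p)" unfolding cycle_def using e p by (auto simp: awalk_Cons_iff)
  moreover have "length (e # p) = card X"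
    using p(2,3) distinct_card[of "awalk_verts u p"] by (simp add: length_awalk_verts)
  ultimately show ?thesis by blast
qed

text \<open>Makes the set of cycle lengths finite, so that \<open>longest_cycle_order\<close> is a
  genuine maximum.\<close>

lemma length_cycle_le:
  assumes "cycle p"
  shows "length p \<le> card (verts G)"
proof -
  obtain u where u: "awalk u p u" "distinct (tl (awalk_verts u p))"
    using assms unfolding cycle_def by blast
  have "length p = card (set (tl (awalk_verts u p)))"
    unfolding distinct_card[OF u(2)] by (simp add: length_awalk_verts)
  also have "\<dots> \<le> card (verts G)"
  proof (rule card_mono[OF finite_verts subsetI])
    fix v assume "v \<in> set (tl (awalk_verts u p))"
    then have "v \<in> set (awalk_verts u p)" by (rule list.set_sel(2)[OF awalk_verts_non_Nil])
    then show "v \<in> verts G" using u(1) unfolding awalk_conv by blast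
  qed
  finally show ?thesis .
qed

lemma two_connected_relation:
  assumes "two_connected G"
  shows "two_connected_relation (dominates G) (verts G)"
proof
  note sep = two_connected_small_separator[OF assms]
  show "finite (verts G)" by (rule finite_verts)
  show "symp (dominates G)" using arcs_ends_symmetric[OF sym_arcs] by (rule sympI)
  show "\<not> v \<rightarrow>\<^bsub>G\<^esub> v" for v by (rule notI) (rule adj_not_same)
  show "v \<in> verts G" if "u \<rightarrow>\<^bsub>G\<^esub> v" for u v by (rule adj_in_verts(2)[OF that])
  have "connected (G \<restriction> verts G)" "card (verts G) \<noteq> 1" using sep[of "{}"] by simp_all
  then have "verts G \<noteq> {}" by (simp add: connected_def strongly_connected_def)
  then obtain v where v: "v \<in> verts G" by blast
  \<comment> \<open>Removing one vertex must not leave exactly one, which rules out order 2.\<close>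
  then have "card (verts G) - 1 \<noteq> 1" using sep(2)[of "{v}"] by simp
  moreover have "card (verts G) \<noteq> 0" using v by auto
  ultimately show "3 \<le> card (verts G)" using \<open>card (verts G) \<noteq> 1\<close> by linarith
  show "(\<lambda>x y. x \<rightarrow>\<^bsub>G\<^esub> y \<and> x \<noteq> c \<and> y \<noteq> c)\<^sup>*\<^sup>* u v"
    if "c \<in> verts G" "u \<in> verts G" "v \<in> verts G" "u \<noteq> c" "v \<noteq> c" for c u v
  proof -
    let ?H = "G \<restriction> (verts G - {c})"
    have "connected ?H" using sep(1)[of "{c}"] that(1) by simp
    then have "u \<rightarrow>\<^sup>*\<^bsub>mk_symmetric ?H\<^esub> v"
      using that by (simp add: connected_def strongly_connected_def)
    then have "(u, v) \<in> (arcs_ends (mk_symmetric ?H))\<^sup>*" by (rule reachable_rtranclI)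
    \<comment> \<open>\<open>connected\<close> refers to the symmetric closure; as \<open>G\<close>
      is symmetric, the closure adds no new adjacency.\<close>
    moreover have "arcs_ends (mk_symmetric ?H) \<subseteq> {(x, y). x \<rightarrow>\<^bsub>G\<^esub> y \<and> x \<noteq> c \<and> y \<noteq> c}"
    proof
      fix w assume "w \<in> arcs_ends (mk_symmetric ?H)"
      then obtain e where e: "e \<in> arcs G" "tail G e \<noteq> c" "head G e \<noteq> c"
        "w = (tail G e, head G e) \<or> w = (head G e, tail G e)"
        by (auto simp: parcs_mk_symmetric)
      have "tail G e \<rightarrow>\<^bsub>G\<^esub> head G e" using e(1) by (rule in_arcs_imp_in_arcs_ends)
      moreover from this have "head G e \<rightarrow>\<^bsub>G\<^esub> tail G e" by (rule arcs_ends_symmetric[OF sym_arcs])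
      ultimately show "w \<in> {(x, y). x \<rightarrow>\<^bsub>G\<^esub> y \<and> x \<noteq> c \<and> y \<noteq> c}" using e(2-4) by auto
    qed
    then have "(arcs_ends (mk_symmetric ?H))\<^sup>* \<subseteq> {(x, y). x \<rightarrow>\<^bsub>G\<^esub> y \<and> x \<noteq> c \<and> y \<noteq> c}\<^sup>*"
      by (rule rtrancl_mono)
    ultimately have "(u, v) \<in> {(x, y). x \<rightarrow>\<^bsub>G\<^esub> y \<and> x \<noteq> c \<and> y \<noteq> c}\<^sup>*"
      by (rule subsetD[rotated])
    then show ?thesis unfolding rtranclp_rtrancl_eq by assumption
  qed
qed

end

theorem theorem3:
  fixes G :: "('a, 'b) pre_digraph"
  assumes "graph G"
    and "two_connected G"
  shows "longest_cycle_order G \<ge>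
    min (longest_path_order G)
      (degree_term G (min_degree G) + degree_term G (min_degree G + 1))"
proof -
  interpret graph G by fact
  interpret rel: two_connected_relation "dominates G" "verts G"
    by (rule two_connected_relation) fact
  let ?a = "degree_term G (min_degree G)" and ?b = "degree_term G (min_degree G + 1)"
  have ne: "verts G \<noteq> {}" using rel.card_V by auto
  have "min_degree G \<in> degree G ` verts G"
    unfolding min_degree_def using ne by (intro Min_in) auto
  \<comment> \<open>Ensures that the index \<open>min_degree G\<close> is at least 1, as
    \<open>degree_term\<close> requires.\<close>
  then have "2 \<le> min_degree G" using rel.degree_ge_2 by (auto simp: card_successors)
  have "\<exists>X u v Y u' v'. rel.longest_path_on X u v \<and> path_on (dominates G) Y u' v' \<and>
    v' \<rightarrow>\<^bsub>G\<^esub> u' \<and> 3 \<le> card Y \<and> min (card X) (?a + ?b) \<le> card Y"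
  proof (rule rel.cycle_ge_degrees)
    show "min_degree G \<le> card {w. v \<rightarrow>\<^bsub>G\<^esub> w}" if "v \<in> verts G" for v
      unfolding card_successors min_degree_def using that by (intro Min_le) auto
    show "\<exists>v\<in>W. ?a \<le> card {w. v \<rightarrow>\<^bsub>G\<^esub> w}" if "W \<subseteq> verts G" "min_degree G \<le> card W" for W
      unfolding card_successors using that \<open>2 \<le> min_degree G\<close> by (intro degree_term_le_degree) auto
    show "\<exists>v\<in>W. ?b \<le> card {w. v \<rightarrow>\<^bsub>G\<^esub> w}" if "W \<subseteq> verts G" "min_degree G + 1 \<le> card W" for W
      unfolding card_successors using that by (intro degree_term_le_degree) auto
  qed
  then obtain X u v Y u' v' where X: "rel.longest_path_on X u v"
    and Y: "path_on (dominates G) Y u' v'" "v' \<rightarrow>\<^bsub>G\<^esub> u'" "3 \<le> card Y" "min (card X) (?a + ?b) \<le> card Y"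
    by (elim exE conjE) (rule that)
  have path_le: "length p \<le> card X" if "vpath p G" for p
  proof -
    have "hd p \<in> verts G" "length p = card (set p)"
      using that by (auto simp: vpath_def vwalk_def distinct_card)
    with rel.longest_path_on_ge[OF X vpath_imp_path_on[OF that]] show ?thesis by simp
  qed
  \<comment> \<open>\<open>Max\<close> is meaningful only on a finite nonempty set: a one-vertex
    path supplies an element, and \<open>path_le\<close> the finiteness.\<close>
  obtain v where "v \<in> verts G" using ne by blast
  then have "vpath [v] G" by (auto simp: vpath_def vwalk_def)
  moreover have "{length p |p. vpath p G} \<subseteq> {..card X}" using path_le by auto
  then have "finite {length p |p. vpath p G}" by (rule finite_subset) simp
  ultimately have "longest_path_order G \<le> card X"
    unfolding longest_path_order_def using path_le by (intro Max.boundedI) auto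
  moreover have "card Y \<le> longest_cycle_order G"
  proof -
    obtain p where "cycle p" "length p = card Y" using path_on_imp_cycle[OF Y(1,2)] by blast
    then have "card Y \<in> {length p |p. cycle p \<and> 3 \<le> length p}"
      using Y(3) by (intro CollectI exI[of _ p]) simp
    moreover have "{length p |p. cycle p \<and> 3 \<le> length p} \<subseteq> {..card (verts G)}"
      using length_cycle_le by auto
    then have "finite {length p |p. cycle p \<and> 3 \<le> length p}" by (rule finite_subset) simp
    ultimately show ?thesis unfolding longest_cycle_order_def by (intro Max_ge)
  qed
  ultimately show ?thesis using Y(4) by linarith
qed

end
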